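(* Let $T$ be a (finite, nonempty) tournament. The following are equivalent: 1. $T$ is diamond-free (no induced subgraph of $T$ is a diamond); 2. $T$ is locally transitive; 3. $T$ is totally decomposable with respect to bijoin decomposition; 4. $T$ can be obtained from a single vertex by a sequence of twin-extensions and antitwin-extensions.
   Context: For a tournament $T$ with vertex set $X$, $N^+(x)$ and $N^-(x)$ denote the out- and in-neighbourhoods of $x$. The standard homogeneous relation of $T$ is: for $x\in X$ and $u,v\in X\setminus\{x\}$, $H(x|uv)$ holds iff $u,v$ both lie in $N^+(x)$ or both lie in $N^-(x)$. A bijoin (umodule) of $T$ is a subset $U\subseteq X$ such that for all $u,u'\in U$ and all $x,x'\in X\setminus U$: $H(u|xx')\Leftrightarrow H(u'|xx')$. It is trivial if $|U|\le 1$ or $|U|\ge |X|-1$. $T$ is totally decomposable with respect to bijoin decomposition if every induced subtournament of $T$ with at least $4$ vertices has a non-trivial bijoin. A diamond is one of the two 4-vertex tournaments consisting of a directed 3-cycle together with a fourth vertex that either dominates all three vertices of the cycle or is dominated by all three. $T$ is locally transitive if for each vertex $x$ the subtournaments induced by $N^+(x)$ and by $N^-(x)$ are transitive. Two vertices $x,y$ are twins if $N^+(x)\setminus\{y\}=N^+(y)\setminus\{x\}$, and antitwins if $N^+(x)\setminus\{y\}=N^-(y)\setminus\{x\}$. A twin-extension (resp. antitwin-extension) of a vertex $x$ of a tournament consists in adding a new vertex $y$ so that the result is a tournament in which $y$ is a twin (resp. antitwin) of $x$ (the arc between $x$ and $y$ being oriented arbitrarily). *)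

theory Defs
  imports "Graph_Theory.Digraph_Component"
begin

text \<open>
  The locale \<^locale>\<open>digraph\<close> provides finiteness and excludes loops and parallel arcs.
  Nonemptiness is not part of it and is assumed where needed.
\<close>

locale tournament = digraph G for G :: "('a, 'b) pre_digraph" (structure) +
  assumes exactly_one_arc:
    "\<lbrakk>u \<in> verts G; v \<in> verts G; u \<noteq> v\<rbrakk> \<Longrightarrow> (u \<rightarrow> v) \<longleftrightarrow> \<not> (v \<rightarrow> u)"

definition out_nbh :: "('a, 'b) pre_digraph \<Rightarrow> 'a \<Rightarrow> 'a set" where
  "out_nbh T x = {y \<in> verts T. x \<rightarrow>\<^bsub>T\<^esub> y}"

definition in_nbh :: "('a, 'b) pre_digraph \<Rightarrow> 'a \<Rightarrow> 'a set" where
  "in_nbh T x = {y \<in> verts T. y \<rightarrow>\<^bsub>T\<^esub> x}"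

text \<open>\<open>homog T x u v\<close> is the relation $H(x|uv)$, meant for \<open>u\<close>, \<open>v\<close> different from \<open>x\<close>.\<close>

definition homog :: "('a, 'b) pre_digraph \<Rightarrow> 'a \<Rightarrow> 'a \<Rightarrow> 'a \<Rightarrow> bool" where
  "homog T x u v \<longleftrightarrow>
     (u \<in> out_nbh T x \<and> v \<in> out_nbh T x) \<or> (u \<in> in_nbh T x \<and> v \<in> in_nbh T x)"

definition bijoin :: "('a, 'b) pre_digraph \<Rightarrow> 'a set \<Rightarrow> bool" where
  "bijoin T U \<longleftrightarrow> U \<subseteq> verts T \<and>
     (\<forall>u \<in> U. \<forall>u' \<in> U. \<forall>x \<in> verts T - U. \<forall>x' \<in> verts T - U.
        homog T u x x' \<longleftrightarrow> homog T u' x x')"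

definition trivial_bijoin :: "('a, 'b) pre_digraph \<Rightarrow> 'a set \<Rightarrow> bool" where
  "trivial_bijoin T U \<longleftrightarrow> card U \<le> 1 \<or> card U \<ge> card (verts T) - 1"

definition totally_decomposable :: "('a, 'b) pre_digraph \<Rightarrow> bool" where
  "totally_decomposable T \<longleftrightarrow>
     (\<forall>W \<subseteq> verts T. card W \<ge> 4 \<longrightarrow>
        (\<exists>U. bijoin (T \<restriction> W) U \<and> \<not> trivial_bijoin (T \<restriction> W) U))"

definition diamond :: "('a, 'b) pre_digraph \<Rightarrow> bool" where
  "diamond D \<longleftrightarrow> tournament D \<and>
     (\<exists>a b c d. distinct [a, b, c, d] \<and> verts D = {a, b, c, d} \<and>
        a \<rightarrow>\<^bsub>D\<^esub> b \<and> b \<rightarrow>\<^bsub>D\<^esub> c \<and> c \<rightarrow>\<^bsub>D\<^esub> a \<and>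
        ((d \<rightarrow>\<^bsub>D\<^esub> a \<and> d \<rightarrow>\<^bsub>D\<^esub> b \<and> d \<rightarrow>\<^bsub>D\<^esub> c) \<or>
         (a \<rightarrow>\<^bsub>D\<^esub> d \<and> b \<rightarrow>\<^bsub>D\<^esub> d \<and> c \<rightarrow>\<^bsub>D\<^esub> d)))"

definition diamond_free :: "('a, 'b) pre_digraph \<Rightarrow> bool" where
  "diamond_free T \<longleftrightarrow> \<not> (\<exists>W \<subseteq> verts T. diamond (T \<restriction> W))"

definition transitive_digraph :: "('a, 'b) pre_digraph \<Rightarrow> bool" where
  "transitive_digraph T \<longleftrightarrow> trans (arcs_ends T)"

definition locally_transitive :: "('a, 'b) pre_digraph \<Rightarrow> bool" where
  "locally_transitive T \<longleftrightarrow>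
     (\<forall>x \<in> verts T. transitive_digraph (T \<restriction> out_nbh T x) \<and>
                    transitive_digraph (T \<restriction> in_nbh T x))"

definition twins :: "('a, 'b) pre_digraph \<Rightarrow> 'a \<Rightarrow> 'a \<Rightarrow> bool" where
  "twins T x y \<longleftrightarrow> out_nbh T x - {y} = out_nbh T y - {x}"

definition antitwins :: "('a, 'b) pre_digraph \<Rightarrow> 'a \<Rightarrow> 'a \<Rightarrow> bool" where
  "antitwins T x y \<longleftrightarrow> out_nbh T x - {y} = in_nbh T y - {x}"

text \<open>\<open>one_vertex_extension G y G'\<close>: the tournament \<open>G'\<close> arises from \<open>G\<close> by adding the new
  vertex \<open>y\<close> and one arc between \<open>y\<close> and each vertex of \<open>G\<close>.\<close>

definition one_vertex_extension ::
    "('a, 'b) pre_digraph \<Rightarrow> 'a \<Rightarrow> ('a, 'b) pre_digraph \<Rightarrow> bool" where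
  "one_vertex_extension G y G' \<longleftrightarrow>
     tournament G' \<and> y \<notin> verts G \<and> verts G' = insert y (verts G) \<and> G' \<restriction> verts G = G"

definition twin_extension ::
    "('a, 'b) pre_digraph \<Rightarrow> 'a \<Rightarrow> 'a \<Rightarrow> ('a, 'b) pre_digraph \<Rightarrow> bool" where
  "twin_extension G x y G' \<longleftrightarrow>
     x \<in> verts G \<and> one_vertex_extension G y G' \<and> twins G' x y"

definition antitwin_extension ::
    "('a, 'b) pre_digraph \<Rightarrow> 'a \<Rightarrow> 'a \<Rightarrow> ('a, 'b) pre_digraph \<Rightarrow> bool" where
  "antitwin_extension G x y G' \<longleftrightarrow>
     x \<in> verts G \<and> one_vertex_extension G y G' \<and> antitwins G' x y"

text \<open>
  The final tournament is built on the nose, not up to isomorphism: since the new vertices and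
  arcs can be named freely, this is no restriction.
\<close>

inductive twin_antitwin_constructible :: "('a, 'b) pre_digraph \<Rightarrow> bool" where
  single: "tournament G \<Longrightarrow> verts G = {v} \<Longrightarrow> twin_antitwin_constructible G"
| twin: "twin_antitwin_constructible G \<Longrightarrow> twin_extension G x y G' \<Longrightarrow>
           twin_antitwin_constructible G'"
| antitwin: "twin_antitwin_constructible G \<Longrightarrow> antitwin_extension G x y G' \<Longrightarrow>
           twin_antitwin_constructible G'"

end

theory Submission
  imports Defs
begin

text \<open>
  Fix a vertex \<open>v\<close> of a tournament without diamonds and reverse all arcs between its
  out-neighbours and its in-neighbours. The other vertices then carry a transitive tournament, since
  a 3-cycle would give a diamond through \<open>v\<close>. The least vertex \<open>u\<close> of the resulting linear order
  is a twin or an antitwin of \<open>v\<close>. Twin and antitwin pairs are exactly the two-element bijoins,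
  so this yields both the non-trivial bijoins and the last step of a construction by extensions.
  Conversely, a diamond contains no two-element bijoin, and a diamond through the new vertex \<open>y\<close> of
  an extension of \<open>x\<close> that avoids \<open>x\<close> can be moved from \<open>y\<close> to \<open>x\<close>, since reversing all
  arcs at one vertex of a diamond gives a diamond.
\<close>

unbundle no funcset_syntax

text \<open>A labelled form with \<open>d\<close> as the vertex off the 3-cycle. In a tournament the
  listed arcs already force distinctness and membership in the vertex set.\<close>

definition diamond_on :: "('a, 'b) pre_digraph \<Rightarrow> 'a \<Rightarrow> 'a \<Rightarrow> 'a \<Rightarrow> 'a \<Rightarrow> bool" where
  "diamond_on T a b c d \<longleftrightarrow> a \<rightarrow>\<^bsub>T\<^esub> b \<and> b \<rightarrow>\<^bsub>T\<^esub> c \<and> c \<rightarrow>\<^bsub>T\<^esub> a \<and>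
     ((d \<rightarrow>\<^bsub>T\<^esub> a \<and> d \<rightarrow>\<^bsub>T\<^esub> b \<and> d \<rightarrow>\<^bsub>T\<^esub> c) \<or>
      (a \<rightarrow>\<^bsub>T\<^esub> d \<and> b \<rightarrow>\<^bsub>T\<^esub> d \<and> c \<rightarrow>\<^bsub>T\<^esub> d))"

lemma diamond_on_rotate: "diamond_on T a b c d \<Longrightarrow> diamond_on T b c a d"
  by (auto simp: diamond_on_def)

lemma dominates_induce_iff:
  "u \<rightarrow>\<^bsub>T \<restriction> W\<^esub> v \<longleftrightarrow> u \<in> W \<and> v \<in> W \<and> u \<rightarrow>\<^bsub>T\<^esub> v"
  by (auto simp: arcs_ends_conv)

section \<open>Diamonds and local transitivity\<close>

context tournament
begin

lemma tournament_induce: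
  assumes "W \<subseteq> verts G"
  shows "tournament (G \<restriction> W)"
proof -
  interpret W: digraph "G \<restriction> W"
    using assms by (intro digraphI_induced induced_induce)
  show ?thesis
    using assms exactly_one_arc by unfold_locales (auto simp: dominates_induce_iff)
qed

lemma not_dominates_self: "\<not> u \<rightarrow> u"
  using adj_not_same by blast

lemma dominates_asym: "u \<rightarrow> v \<Longrightarrow> \<not> v \<rightarrow> u"
  using exactly_one_arc adj_in_verts not_dominates_self by metis

lemma homog_iff: "homog G x u v \<longleftrightarrow> (x \<rightarrow> u \<and> x \<rightarrow> v) \<or> (u \<rightarrow> x \<and> v \<rightarrow> x)"
  by (auto simp: homog_def out_nbh_def in_nbh_def dest: adj_in_verts)

lemma diamond_on_distinct: "diamond_on G a b c d \<Longrightarrow> distinct [a, b, c, d]"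
  using not_dominates_self dominates_asym by (auto simp: diamond_on_def)

lemma diamond_on_verts: "diamond_on G a b c d \<Longrightarrow> {a, b, c, d} \<subseteq> verts G"
  by (auto simp: diamond_on_def dest: adj_in_verts)

text \<open>The absence of labelled diamonds is the common form with which all four conditions are
  compared.\<close>

lemma diamond_free_iff: "diamond_free G \<longleftrightarrow> \<not> (\<exists>a b c d. diamond_on G a b c d)"
proof
  assume free: "diamond_free G"
  show "\<not> (\<exists>a b c d. diamond_on G a b c d)"
  proof safe
    fix a b c d assume D: "diamond_on G a b c d"
    have "diamond (G \<restriction> {a, b, c, d})"
      unfolding diamond_def
    proof (intro conjI exI)
      show "tournament (G \<restriction> {a, b, c, d})"
        using diamond_on_verts[OF D] by (rule tournament_induce)
      show "distinct [a, b, c, d]" by (rule diamond_on_distinct[OF D])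
    qed (use D in \<open>auto simp: diamond_on_def dominates_induce_iff\<close>)
    with free diamond_on_verts[OF D] show False
      by (auto simp: diamond_free_def)
  qed
next
  assume "\<not> (\<exists>a b c d. diamond_on G a b c d)"
  then show "diamond_free G"
    unfolding diamond_free_def diamond_def diamond_on_def dominates_induce_iff by blast
qed

text \<open>By asymmetry \<open>a \<rightarrow> b \<rightarrow> c\<close> forces
  \<open>a \<noteq> c\<close>, so a failure of transitivity puts the arc
  \<open>c \<rightarrow> a\<close> in place and closes a 3-cycle.\<close>

lemma transitive_induce_iff:
  assumes "W \<subseteq> verts G"
  shows "transitive_digraph (G \<restriction> W) \<longleftrightarrow>
    \<not> (\<exists>a \<in> W. \<exists>b \<in> W. \<exists>c \<in> W. a \<rightarrow> b \<and> b \<rightarrow> c \<and> c \<rightarrow> a)"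
proof
  assume "transitive_digraph (G \<restriction> W)"
  then have "\<And>a b c. \<lbrakk>a \<in> W; b \<in> W; c \<in> W; a \<rightarrow> b; b \<rightarrow> c\<rbrakk> \<Longrightarrow> a \<rightarrow> c"
    unfolding transitive_digraph_def trans_def dominates_induce_iff by blast
  then show "\<not> (\<exists>a \<in> W. \<exists>b \<in> W. \<exists>c \<in> W. a \<rightarrow> b \<and> b \<rightarrow> c \<and> c \<rightarrow> a)"
    using dominates_asym by blast
next
  assume acyclic: "\<not> (\<exists>a \<in> W. \<exists>b \<in> W. \<exists>c \<in> W. a \<rightarrow> b \<and> b \<rightarrow> c \<and> c \<rightarrow> a)"
  show "transitive_digraph (G \<restriction> W)"
    unfolding transitive_digraph_def
  proof (rule transI)
    fix a b c assume "a \<rightarrow>\<^bsub>G \<restriction> W\<^esub> b" "b \<rightarrow>\<^bsub>G \<restriction> W\<^esub> c"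
    then have "a \<in> W" "b \<in> W" "c \<in> W" "a \<rightarrow> b" "b \<rightarrow> c"
      by (auto simp: dominates_induce_iff)
    moreover from this have "a \<noteq> c" using dominates_asym by blast
    ultimately have "a \<rightarrow> c"
      using acyclic exactly_one_arc assms by blast
    with \<open>a \<in> W\<close> \<open>c \<in> W\<close> show "a \<rightarrow>\<^bsub>G \<restriction> W\<^esub> c" by (simp add: dominates_induce_iff)
  qed
qed

text \<open>A 3-cycle inside a neighbourhood of \<open>x\<close> is exactly a diamond whose fourth
  vertex is \<open>x\<close>.\<close>

lemma locally_transitive_iff: "locally_transitive G \<longleftrightarrow> \<not> (\<exists>a b c d. diamond_on G a b c d)"
proof -
  have sub: "out_nbh G x \<subseteq> verts G" "in_nbh G x \<subseteq> verts G" for x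
    by (auto simp: out_nbh_def in_nbh_def)
  have nbh: "y \<in> out_nbh G x \<longleftrightarrow> x \<rightarrow> y" "y \<in> in_nbh G x \<longleftrightarrow> y \<rightarrow> x" for x y
    by (auto simp: out_nbh_def in_nbh_def dest: adj_in_verts)
  show ?thesis
    unfolding locally_transitive_def sub[THEN transitive_induce_iff] Bex_def nbh diamond_on_def
    using adj_in_verts by blast
qed

section \<open>Twins, antitwins and two-element bijoins\<close>

lemma twins_iff:
  assumes "x \<in> verts G" "y \<in> verts G" "x \<noteq> y"
  shows "twins G x y \<longleftrightarrow> (\<forall>w \<in> verts G - {x, y}. x \<rightarrow> w \<longleftrightarrow> y \<rightarrow> w)"
  using assms not_dominates_self unfolding twins_def out_nbh_def by (auto simp: set_eq_iff)

lemma antitwins_iff: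
  assumes "x \<in> verts G" "y \<in> verts G" "x \<noteq> y"
  shows "antitwins G x y \<longleftrightarrow> (\<forall>w \<in> verts G - {x, y}. x \<rightarrow> w \<longleftrightarrow> w \<rightarrow> y)"
  using assms not_dominates_self unfolding antitwins_def out_nbh_def in_nbh_def
  by (auto simp: set_eq_iff)

text \<open>\<open>homog\<close> sees only the partition of the other vertices into out- and
  in-neighbours, not which class is which. Equal partitions with equal labels mean twins, with
  swapped labels antitwins.\<close>

lemma bijoin_pair_iff:
  assumes "x \<in> verts G" "y \<in> verts G" "x \<noteq> y"
  shows "bijoin G {x, y} \<longleftrightarrow> twins G x y \<or> antitwins G x y"
proof -
  have flip: "w \<rightarrow> x \<longleftrightarrow> \<not> x \<rightarrow> w" "w \<rightarrow> y \<longleftrightarrow> \<not> y \<rightarrow> w" if "w \<in> verts G - {x, y}" for w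
    using assms that exactly_one_arc by auto
  have "bijoin G {x, y} \<longleftrightarrow> (\<forall>w \<in> verts G - {x, y}. \<forall>w' \<in> verts G - {x, y}.
      (x \<rightarrow> w \<longleftrightarrow> x \<rightarrow> w') \<longleftrightarrow> (y \<rightarrow> w \<longleftrightarrow> y \<rightarrow> w'))"
    using assms flip by (auto simp: bijoin_def homog_iff)
  also have "\<dots> \<longleftrightarrow> twins G x y \<or> antitwins G x y"
    unfolding twins_iff[OF assms] antitwins_iff[OF assms] using flip by blast
  finally show ?thesis .
qed

text \<open>The vertex off the cycle treats any two cycle vertices alike, while a cycle vertex
  separates the other two. Of two cycle vertices, exactly one separates the remaining two
  vertices.\<close>

lemma bijoin_pair_not_in_diamond:
  assumes D: "diamond_on G a b c d" and xy: "x \<in> {a, b, c, d}" "y \<in> {a, b, c, d}" "x \<noteq> y"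
    and B: "bijoin G {x, y}"
  shows False
proof -
  have V: "a \<in> verts G" "b \<in> verts G" "c \<in> verts G" "d \<in> verts G"
    using diamond_on_verts[OF D] by auto
  have ne: "a \<noteq> b" "a \<noteq> c" "a \<noteq> d" "b \<noteq> c" "b \<noteq> d" "c \<noteq> d"
    using diamond_on_distinct[OF D] by auto
  have "homog G x w w' \<longleftrightarrow> homog G y w w'"
    if "w \<in> {a, b, c, d} - {x, y}" "w' \<in> {a, b, c, d} - {x, y}" for w w'
    using B that V unfolding bijoin_def by blast
  then show False
    using xy D ne unfolding homog_iff diamond_on_def
    by (elim insertE emptyE; simp; metis dominates_asym)
qed

lemma ex_bijoin_pair:
  assumes free: "\<not> (\<exists>a b c d. diamond_on G a b c d)"
    and v: "v \<in> verts G" "verts G \<noteq> {v}"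
  shows "\<exists>u \<in> verts G - {v}. bijoin G {v, u}"
proof -
  \<comment> \<open>The arc relation after the reversal: it keeps arcs between vertices on the same
    side of \<open>v\<close> and flips arcs between the two sides.\<close>
  define R where "R x y \<longleftrightarrow> (x \<rightarrow> y \<longleftrightarrow> (v \<rightarrow> x \<longleftrightarrow> v \<rightarrow> y))" for x y
  let ?V = "verts G - {v}"
  have flip: "w \<rightarrow> w' \<longleftrightarrow> \<not> w' \<rightarrow> w" if "w \<in> verts G" "w' \<in> verts G" "w \<noteq> w'" for w w'
    using exactly_one_arc that .
  have total: "R x y \<longleftrightarrow> \<not> R y x" if "x \<in> ?V" "y \<in> ?V" "x \<noteq> y" for x y
    using flip[of x y] that by (auto simp: R_def)
  have trans: "R x z" if "x \<in> ?V" "y \<in> ?V" "z \<in> ?V" "x \<noteq> y" "y \<noteq> z" "x \<noteq> z" "R x y" "R y z"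
    for x y z
  proof (rule ccontr)
    assume "\<not> R x z"
    then have "R z x" using total[of x z] that by simp
    have rev: "y \<rightarrow> x \<longleftrightarrow> \<not> x \<rightarrow> y" "z \<rightarrow> y \<longleftrightarrow> \<not> y \<rightarrow> z" "x \<rightarrow> z \<longleftrightarrow> \<not> z \<rightarrow> x"
      "v \<rightarrow> x \<longleftrightarrow> \<not> x \<rightarrow> v" "v \<rightarrow> y \<longleftrightarrow> \<not> y \<rightarrow> v" "v \<rightarrow> z \<longleftrightarrow> \<not> z \<rightarrow> v"
      using that v by (intro flip; blast)+
    \<comment> \<open>The first disjunct covers \<open>x\<close>, \<open>y\<close>, \<open>z\<close>
      on one side of \<open>v\<close>. Otherwise one is alone on its side, say \<open>x\<close>;
      then \<open>y \<rightarrow> x\<close>, \<open>x \<rightarrow> z\<close>,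
      \<open>y \<rightarrow> z\<close>, and \<open>v\<close> closes a 3-cycle with \<open>x\<close>
      and one of \<open>y\<close>, \<open>z\<close>, the other being the fourth vertex. Three
      choices of the lone vertex and two sides give six cases.\<close>
    have "diamond_on G x y z v \<or> diamond_on G v x y z \<or> diamond_on G v y z x
        \<or> diamond_on G v z x y \<or> diamond_on G v y x z \<or> diamond_on G v z y x
        \<or> diamond_on G v x z y"
      using \<open>R x y\<close> \<open>R y z\<close> \<open>R z x\<close> unfolding R_def diamond_on_def rev
      by (cases "x \<rightarrow> v"; cases "y \<rightarrow> v"; cases "z \<rightarrow> v"; simp)
    with free show False by blast
  qed
  have "\<exists>u \<in> S. \<forall>w \<in> S - {u}. R u w" if "finite S" "S \<noteq> {}" "S \<subseteq> ?V" for S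
    using that
  proof (induction S rule: finite_ne_induct)
    case (insert s S)
    then obtain u where u: "u \<in> S" "\<And>w. w \<in> S - {u} \<Longrightarrow> R u w" by auto
    show ?case
    proof (cases "R u s")
      case True
      with u show ?thesis by auto
    next
      case False
      then have "R s u" using total[of u s] u insert by auto
      then have "R s w" if "w \<in> S" for w
        using trans[of s u w] u that insert by (cases "w = u") auto
      then show ?thesis by auto
    qed
  qed auto
  from this[of ?V] v obtain u where u: "u \<in> ?V" "\<And>w. w \<in> ?V - {u} \<Longrightarrow> R u w"
    by auto
  \<comment> \<open>For \<open>v \<rightarrow> u\<close>, minimality \<open>R u w\<close> says that
    \<open>u\<close> and \<open>v\<close> have the same arc direction to \<open>w\<close>; for
    \<open>u \<rightarrow> v\<close> it says that they have opposite ones.\<close>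
  have "twins G v u \<or> antitwins G v u"
  proof (cases "v \<rightarrow> u")
    case True
    then show ?thesis
      using u v twins_iff[of v u] by (auto simp: R_def)
  next
    case False
    then have "v \<rightarrow> w \<longleftrightarrow> w \<rightarrow> u" if "w \<in> verts G - {v, u}" for w
      using u that flip[of w u] by (auto simp: R_def)
    then show ?thesis using u v antitwins_iff[of v u] by auto
  qed
  then show ?thesis using u v bijoin_pair_iff[of v u] by auto
qed

text \<open>On four vertices a non-trivial bijoin has exactly two elements, and on four or more
  vertices every two-element bijoin is non-trivial.\<close>

lemma totally_decomposable_iff:
  "totally_decomposable G \<longleftrightarrow> \<not> (\<exists>a b c d. diamond_on G a b c d)"
proof
  assume td: "totally_decomposable G"
  show "\<not> (\<exists>a b c d. diamond_on G a b c d)"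
  proof safe
    fix a b c d assume D: "diamond_on G a b c d"
    let ?W = "{a, b, c, d}"
    have W: "?W \<subseteq> verts G" "card ?W = 4"
      using diamond_on_verts[OF D] diamond_on_distinct[OF D] by auto
    interpret W: tournament "G \<restriction> ?W" using W(1) by (rule tournament_induce)
    obtain U where U: "bijoin (G \<restriction> ?W) U" "\<not> trivial_bijoin (G \<restriction> ?W) U"
      using td W unfolding totally_decomposable_def by (metis order_refl)
    then have "card U = 2" using W by (auto simp: trivial_bijoin_def)
    then obtain x y where xy: "U = {x, y}" "x \<noteq> y" by (auto simp: card_2_iff)
    have "diamond_on (G \<restriction> ?W) a b c d"
      using D by (auto simp: diamond_on_def dominates_induce_iff)
    moreover have "x \<in> ?W" "y \<in> ?W" using U xy by (auto simp: bijoin_def)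
    ultimately show False
      using W.bijoin_pair_not_in_diamond U xy by metis
  qed
next
  assume free: "\<not> (\<exists>a b c d. diamond_on G a b c d)"
  show "totally_decomposable G"
    unfolding totally_decomposable_def
  proof (intro allI impI)
    fix W assume W: "W \<subseteq> verts G" "4 \<le> card W"
    interpret W: tournament "G \<restriction> W" using W(1) by (rule tournament_induce)
    have "W \<noteq> {}" "\<And>v. W \<noteq> {v}" using W(2) by auto
    then obtain v where v: "v \<in> W" "W \<noteq> {v}" by blast
    moreover have "\<not> (\<exists>a b c d. diamond_on (G \<restriction> W) a b c d)"
      using free unfolding diamond_on_def dominates_induce_iff by blast
    ultimately obtain u where "u \<in> W - {v}" "bijoin (G \<restriction> W) {v, u}"
      using W.ex_bijoin_pair[of v] by auto
    with W(2) show "\<exists>U. bijoin (G \<restriction> W) U \<and> \<not> trivial_bijoin (G \<restriction> W) U"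
      by (intro exI[of _ "{v, u}"]) (auto simp: trivial_bijoin_def)
  qed
qed

section \<open>Extensions and diamonds\<close>

lemma diamond_on_replace:
  assumes D: "diamond_on G a b c d" and y: "y \<in> {a, b, c, d}" and x: "x \<notin> {a, b, c, d}"
    and xV: "x \<in> verts G" and B: "bijoin G {x, y}"
  shows "\<exists>a' b' c' d'. diamond_on G a' b' c' d' \<and> y \<notin> {a', b', c', d'}"
proof -
  have V: "a \<in> verts G" "b \<in> verts G" "c \<in> verts G" "d \<in> verts G"
    using diamond_on_verts[OF D] by auto
  have "y \<in> verts G" "x \<noteq> y" using V x y by auto
  note xy = xV this
  have flip: "w \<rightarrow> x \<longleftrightarrow> \<not> x \<rightarrow> w" "w \<rightarrow> y \<longleftrightarrow> \<not> y \<rightarrow> w" if "w \<in> verts G - {x, y}" for w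
    using xy that exactly_one_arc by auto
  have cases: "(\<forall>w \<in> verts G - {x, y}. (x \<rightarrow> w \<longleftrightarrow> y \<rightarrow> w) \<and> (w \<rightarrow> x \<longleftrightarrow> w \<rightarrow> y)) \<or>
      (\<forall>w \<in> verts G - {x, y}. (x \<rightarrow> w \<longleftrightarrow> w \<rightarrow> y) \<and> (w \<rightarrow> x \<longleftrightarrow> y \<rightarrow> w))"
    using B flip unfolding bijoin_pair_iff[OF xy] twins_iff[OF xy] antitwins_iff[OF xy] by blast
  \<comment> \<open>Rotating the cycle brings \<open>y\<close> to its first position.\<close>
  have on_cycle: ?thesis if D': "diamond_on G y b' c' d'" and x': "x \<notin> {b', c', d'}" for b' c' d'
  proof -
    have V': "b' \<in> verts G - {x, y}" "c' \<in> verts G - {x, y}" "d' \<in> verts G - {x, y}"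
      using diamond_on_verts[OF D'] diamond_on_distinct[OF D'] x' by auto
    \<comment> \<open>Twins give the first disjunct. For antitwins the arcs at \<open>y\<close> are
      reversed: the second arises when \<open>d'\<close> dominates the old cycle, the third when it
      is dominated by it.\<close>
    have "diamond_on G x b' c' d' \<or> diamond_on G x d' b' c' \<or> diamond_on G x c' d' b'"
      using cases D' V' unfolding diamond_on_def by blast
    then show ?thesis using V' xy(3) by blast
  qed
  show ?thesis
  proof (cases "y = d")
    case True
    then have V': "a \<in> verts G - {x, y}" "b \<in> verts G - {x, y}" "c \<in> verts G - {x, y}"
      using V diamond_on_distinct[OF D] x by auto
    \<comment> \<open>An antitwin only exchanges the two kinds of diamond here.\<close>
    have "diamond_on G a b c x"
      using cases D V' True unfolding diamond_on_def by blast
    then show ?thesis using V' xy(3) by blast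
  next
    case False
    then show ?thesis
      using y x on_cycle D diamond_on_rotate[OF D] diamond_on_rotate[OF diamond_on_rotate[OF D]]
      by (metis insert_iff singletonD)
  qed
qed

end

lemma diamond_on_extension:
  assumes "one_vertex_extension G y G'" "x \<in> verts G" "twins G' x y \<or> antitwins G' x y"
    and free: "\<not> (\<exists>a b c d. diamond_on G a b c d)"
  shows "\<not> (\<exists>a b c d. diamond_on G' a b c d)"
proof
  interpret G': tournament G' using assms(1) by (simp add: one_vertex_extension_def)
  have G: "verts G' = insert y (verts G)" "y \<notin> verts G" "G' \<restriction> verts G = G"
    using assms(1) by (auto simp: one_vertex_extension_def)
  have xy: "x \<in> verts G'" "y \<in> verts G'" "x \<noteq> y" using G assms(2) by auto
  have B: "bijoin G' {x, y}" using assms(3) G'.bijoin_pair_iff[OF xy] by simp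
  have without: False if "diamond_on G' a b c d" "y \<notin> {a, b, c, d}" for a b c d
  proof -
    have "{a, b, c, d} \<subseteq> verts G" using G'.diamond_on_verts[OF that(1)] that(2) G(1) by auto
    then have "diamond_on (G' \<restriction> verts G) a b c d"
      using that(1) by (auto simp: diamond_on_def dominates_induce_iff)
    with free G(3) show False by auto
  qed
  assume "\<exists>a b c d. diamond_on G' a b c d"
  then obtain a b c d where D: "diamond_on G' a b c d" by blast
  then have "y \<in> {a, b, c, d}" using without by blast
  moreover from this have "x \<notin> {a, b, c, d}"
    using G'.bijoin_pair_not_in_diamond[OF D] B xy(3) by blast
  ultimately show False
    using G'.diamond_on_replace[OF D] xy(1) B without by blast
qed

lemma constructible_imp_no_diamond:
  "twin_antitwin_constructible T \<Longrightarrow> \<not> (\<exists>a b c d. diamond_on T a b c d)"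
proof (induction rule: twin_antitwin_constructible.induct)
  case (single G v)
  then show ?case
    using tournament.diamond_on_verts tournament.diamond_on_distinct by fastforce
next
  case (twin G x y G')
  then show ?case
    unfolding twin_extension_def by (intro diamond_on_extension[of G y G' x]) auto
next
  case (antitwin G x y G')
  then show ?case
    unfolding antitwin_extension_def by (intro diamond_on_extension[of G y G' x]) auto
qed

text \<open>Deleting one vertex of a two-element bijoin undoes an extension and creates no diamond,
  so induction on the number of vertices applies.\<close>

lemma no_diamond_imp_constructible:
  assumes "tournament T" "verts T \<noteq> {}" "\<not> (\<exists>a b c d. diamond_on T a b c d)"
  shows "twin_antitwin_constructible T"
  using assms
proof (induction "card (verts T)" arbitrary: T rule: less_induct)
  case less
  interpret tournament T by fact
  obtain v where v: "v \<in> verts T" using less.prems by blast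
  show ?case
  proof (cases "verts T = {v}")
    case True
    then show ?thesis using less.prems by (intro twin_antitwin_constructible.single)
  next
    case False
    obtain u where u: "u \<in> verts T" "u \<noteq> v" "bijoin T {v, u}"
      using ex_bijoin_pair[OF less.prems(3) v False] by blast
    let ?T = "T \<restriction> (verts T - {u})"
    have "tournament ?T" by (intro tournament_induce) blast
    moreover have "\<not> (\<exists>a b c d. diamond_on ?T a b c d)"
      using less.prems(3) unfolding diamond_on_def dominates_induce_iff by blast
    moreover have "card (verts ?T) < card (verts T)"
      unfolding induce_subgraph_verts using u by (intro card_Diff1_less) auto
    moreover have "verts ?T \<noteq> {}" using v u by auto
    ultimately have con: "twin_antitwin_constructible ?T"
      by (intro less.hyps)
    have ext: "one_vertex_extension ?T u T"
      using u less.prems by (auto simp: one_vertex_extension_def)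
    have "twins T v u \<or> antitwins T v u"
      using bijoin_pair_iff[of v u] v u by simp
    then have "twin_extension ?T v u T \<or> antitwin_extension ?T v u T"
      using ext v u by (auto simp: twin_extension_def antitwin_extension_def)
    with con show ?thesis
      by (elim disjE) (rule twin_antitwin_constructible.intros; assumption)+
  qed
qed

theorem theorem7:
  fixes T :: "('a, 'b) pre_digraph"
  assumes "tournament T" and "verts T \<noteq> {}"
  shows "(diamond_free T \<longleftrightarrow> locally_transitive T) \<and>
         (locally_transitive T \<longleftrightarrow> totally_decomposable T) \<and>
         (totally_decomposable T \<longleftrightarrow> twin_antitwin_constructible T)"
proof -
  interpret tournament T by fact
  show ?thesis
    using diamond_free_iff locally_transitive_iff totally_decomposable_iff
      constructible_imp_no_diamond no_diamond_imp_constructible[OF assms] by blast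
qed

end
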